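(* Let $A=(\mathcal{A},w)$ be a constrained system with generating function $G_A(s)=\sum_{a\in\mathcal{A}}e^{-w(a)s}$, let $Q$ be the abscissa of convergence of $G_A$, and let $\mathsf{C}$ be the combinatorial capacity of $A$. Let $Y=\{Y_l\}_{l=1}^\infty$ be an input process of $A$. Then the entropy rate of $Y$ satisfies $$\bar{H}(Y)=\limsup_{l\to\infty}\frac{H(Y_1,\dotsc,Y_l)}{\mathrm{E}[w(Y_1)+\dotsb+w(Y_l)]}\le Q,$$ and in particular $\bar{H}(Y)\le\mathsf{C}$.
   Context: A constrained system $A=(\mathcal{A},w)$ consists of a countable set $\mathcal{A}$ of strings and a weight function $w\colon\mathcal{A}\to\mathbb{R}_{>0}$ (positive real numbers) such that whenever $\mathtt{a},\mathtt{b}\in\mathcal{A}$ and the concatenation $\mathtt{a}\mathtt{b}\in\mathcal{A}$, then $w(\mathtt{a}\mathtt{b})=w(\mathtt{a})+w(\mathtt{b})$. $\Omega$ denotes the set of distinct values $w(a)$, $a\in\mathcal{A}$, ordered and indexed as $\Omega=\{\nu_k\}_{k=1}^\infty$ with $\nu_1<\nu_2<\dotsb$. $N(\nu_k)$ denotes the (finite) number of distinct strings of weight $\nu_k$ in $\mathcal{A}$. The combinatorial capacity is $\mathsf{C}=\limsup_{k\to\infty}\frac{\ln[\sum_{l=1}^k N(\nu_l)]}{\nu_k}$. The abscissa of convergence $Q$ of $G_A(s)=\sum_{k=1}^\infty N(\nu_k)e^{-\nu_k s}$, $s\in\mathbb{C}$, is the infimum, in the extended reals, of all $\sigma\in\mathbb{R}$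 such that the series converges at $s=\sigma$. Input source: a sequence $X=\{X_l\}_{l=1}^\infty$ of random variables, with $\mathcal{X}_l$ the support of $X_l$, is an input source of $A$ if and only if (i) $\bigcup_{l=1}^\infty\mathcal{X}_l\subseteq\mathcal{A}$ and $\mathcal{X}_l\cap\mathcal{X}_k=\emptyset$ for $l\ne k$, and (ii) $\mathcal{X}_l\neq\emptyset$ for each $l\in\mathbb{N}$. Input process: let $\operatorname{cat}$ denote concatenation of strings, $\operatorname{cat}(\mathtt{a},\mathtt{b})=\mathtt{a}\mathtt{b}$. A random process $Y=\{Y_l\}_{l=1}^\infty$ with $Y_l$ taking values in a countable set of strings $\mathcal{Y}$ is an input process of $A$ if the sequence of random variables $X_l=\operatorname{cat}(Y_1,\dotsc,Y_l)$, with supports $$\mathcal{X}_l=\{\operatorname{cat}(y_1,\dotsc,y_l)\mid (y_1,\dotsc,y_l)\in\mathcal{Y}^l,\ p_Y(y_1,\dotsc,y_l)>0\},$$ is an input source of $A$, where $p_Y(y_1,\dotsc,y_l)$ denotes the joint probability of $(Y_1,\dotsc,Y_l)=(y_1,\dotsc,y_l)$. The weight function is understood to be defined (with positive real values) also on the strings of $\mathcal{Y}$, with $w(\operatorname{cat}(y_1,\dotsc,y_l))=w(y_1)+\dotsb+w(y_l)$ for all $(y_1,\dotsc,y_l)$ of positive probability. $H$ denotes Shannon entropy in nats ($\ln$ is the natural logarithm) and $\mathrm{E}$ denotes expectation.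
   Formalization: Added hypothesis: for each l, cat is injective on the l-tuples of positive probability (X_l determines Y_1,…,Y_l); without it the claim fails, e.g. 𝒴={a,ab,ba}, iid probabilities 1/2,1/4,1/4, w=length, where the rate is ln 2 > C. *)

theory Defs
  imports "HOL-Probability.Probability"
begin

subsection \<open>Constrained systems\<close>

definition constrained_system :: "'s list set \<Rightarrow> ('s list \<Rightarrow> real) \<Rightarrow> bool" where
  "constrained_system \<A> w \<longleftrightarrow>
     countable \<A> \<and> (\<forall>a\<in>\<A>. 0 < w a) \<and>
     (\<forall>a\<in>\<A>. \<forall>b\<in>\<A>. a @ b \<in> \<A> \<longrightarrow> w (a @ b) = w a + w b)"

definition num_strings :: "'s list set \<Rightarrow> ('s list \<Rightarrow> real) \<Rightarrow> real \<Rightarrow> nat" where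
  "num_strings \<A> w v = card {a \<in> \<A>. w a = v}"

text \<open>
  The increasing enumeration of the set of weights. Sequences are indexed from \<open>0\<close> here, so
  \<open>\<nu> k\<close> is the weight usually written \<open>\<nu>\<close> with index \<open>k + 1\<close>. The weights may be bounded;
  the abscissa and the capacity defined below are then both infinite.
\<close>

definition weight_enumeration ::
    "'s list set \<Rightarrow> ('s list \<Rightarrow> real) \<Rightarrow> (nat \<Rightarrow> real) \<Rightarrow> bool" where
  "weight_enumeration \<A> w \<nu> \<longleftrightarrow>
     strict_mono \<nu> \<and> range \<nu> = w ` \<A> \<and> (\<forall>k. finite {a \<in> \<A>. w a = \<nu> k})"

definition combinatorial_capacity ::
    "'s list set \<Rightarrow> ('s list \<Rightarrow> real) \<Rightarrow> (nat \<Rightarrow> real) \<Rightarrow> ereal" where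
  "combinatorial_capacity \<A> w \<nu> =
     limsup (\<lambda>k. ereal (ln (\<Sum>l\<le>k. real (num_strings \<A> w (\<nu> l))) / \<nu> k))"

text \<open>
  The terms of the series of the generating function: its value at \<open>s\<close> is
  \<open>\<Sum>k. generating_series \<A> w \<nu> s k\<close>, that is, the sum of \<open>exp (- w a * s)\<close> over all \<open>a \<in> \<A>\<close>
  with the strings of equal weight collected.
\<close>

definition generating_series ::
    "'s list set \<Rightarrow> ('s list \<Rightarrow> real) \<Rightarrow> (nat \<Rightarrow> real) \<Rightarrow> complex \<Rightarrow> nat \<Rightarrow> complex" where
  "generating_series \<A> w \<nu> s k =
     of_nat (num_strings \<A> w (\<nu> k)) * exp (- (of_real (\<nu> k) * s))"

definition abscissa_of_convergence :: "(complex \<Rightarrow> nat \<Rightarrow> complex) \<Rightarrow> ereal" where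
  "abscissa_of_convergence F = Inf (ereal ` {\<sigma>. summable (F (of_real \<sigma>))})"

subsection \<open>Input sources and input processes\<close>

definition prob_mass :: "'a measure \<Rightarrow> ('a \<Rightarrow> 'b) \<Rightarrow> 'b \<Rightarrow> real" where
  "prob_mass M X x = measure M {\<omega> \<in> space M. X \<omega> = x}"

definition support :: "'a measure \<Rightarrow> ('a \<Rightarrow> 'b) \<Rightarrow> 'b set" where
  "support M X = {x. 0 < prob_mass M X x}"

definition input_source :: "'s list set \<Rightarrow> 'a measure \<Rightarrow> (nat \<Rightarrow> 'a \<Rightarrow> 's list) \<Rightarrow> bool" where
  "input_source \<A> M X \<longleftrightarrow>
     (\<Union>l. support M (X l)) \<subseteq> \<A> \<and>
     (\<forall>l k. l \<noteq> k \<longrightarrow> support M (X l) \<inter> support M (X k) = {}) \<and>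
     (\<forall>l. support M (X l) \<noteq> {})"

text \<open>\<open>joint Y l\<close> is the random tuple of the first \<open>l\<close> variables \<open>Y 0, \<dots>, Y (l - 1)\<close>, as a list.\<close>

definition joint :: "(nat \<Rightarrow> 'a \<Rightarrow> 'b) \<Rightarrow> nat \<Rightarrow> 'a \<Rightarrow> 'b list" where
  "joint Y l \<omega> = map (\<lambda>i. Y i \<omega>) [0..<l]"

definition input_process ::
    "'s list set \<Rightarrow> 'a measure \<Rightarrow> 's list set \<Rightarrow> (nat \<Rightarrow> 'a \<Rightarrow> 's list) \<Rightarrow> bool" where
  "input_process \<A> M \<Y> Y \<longleftrightarrow>
     prob_space M \<and> countable \<Y> \<and> (\<forall>l. Y l \<in> measurable M (count_space \<Y>)) \<and>
     input_source \<A> M (\<lambda>l \<omega>. concat (joint Y (Suc l) \<omega>))"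

definition positive_tuples ::
    "'a measure \<Rightarrow> 'b set \<Rightarrow> (nat \<Rightarrow> 'a \<Rightarrow> 'b) \<Rightarrow> nat \<Rightarrow> 'b list set" where
  "positive_tuples M \<Y> Y l =
     {ys. length ys = l \<and> set ys \<subseteq> \<Y> \<and> 0 < prob_mass M (joint Y l) ys}"

text \<open>
  The support of the concatenation of the first \<open>l\<close> variables consists of the concatenations of
  the \<open>l\<close>-tuples of positive probability.
\<close>

lemma support_concat_joint:
  assumes "prob_space M" and "countable \<Y>" and Y: "\<And>i. Y i \<in> measurable M (count_space \<Y>)"
  shows "support M (\<lambda>\<omega>. concat (joint Y l \<omega>)) = concat ` positive_tuples M \<Y> Y l"
proof -
  interpret prob_space M by fact
  define T where "T = {ys. length ys = l \<and> set ys \<subseteq> \<Y>}"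
  have "countable (lists \<Y>)"
    using assms(2) by (rule countable_lists)
  then have T: "countable T"
    by (rule countable_subset[rotated]) (auto simp: T_def lists_eq_set)
  have in_T: "joint Y l \<omega> \<in> T" if "\<omega> \<in> space M" for \<omega>
    using measurable_space[OF Y that] by (auto simp: T_def joint_def)
  have meas: "{\<omega> \<in> space M. joint Y l \<omega> = ys} \<in> sets M" for ys
  proof -
    have "{\<omega> \<in> space M. Y i \<omega> = y} \<in> sets M" for i y
    proof -
      have "{\<omega> \<in> space M. Y i \<omega> = y} = Y i -` ({y} \<inter> \<Y>) \<inter> space M"
        using measurable_space[OF Y] by auto
      also have "\<dots> \<in> sets M"
        by (rule measurable_sets[OF Y]) auto
      finally show ?thesis .
    qed
    then have *: "{\<omega> \<in> space M. \<forall>i\<in>{..<l}. Y i \<omega> = ys ! i} \<in> sets M"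
      by (intro sets.sets_Collect_finite_All) auto
    show ?thesis
    proof (cases "length ys = l")
      case True
      then have "{\<omega> \<in> space M. joint Y l \<omega> = ys} = {\<omega> \<in> space M. \<forall>i\<in>{..<l}. Y i \<omega> = ys ! i}"
        by (auto simp: joint_def list_eq_iff_nth_eq)
      with * show ?thesis by simp
    next
      case False
      then have "{\<omega> \<in> space M. joint Y l \<omega> = ys} = {}"
        by (auto simp: joint_def)
      then show ?thesis by (metis sets.empty_sets)
    qed
  qed
  have dec: "{\<omega> \<in> space M. concat (joint Y l \<omega>) = x} =
      (\<Union>ys\<in>{ys\<in>T. concat ys = x}. {\<omega> \<in> space M. joint Y l \<omega> = ys})" for x
    using in_T by auto
  have T': "countable {ys\<in>T. concat ys = x}" for x
    using T by (rule countable_subset[rotated]) auto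
  show ?thesis
  proof (intro equalityI subsetI)
    fix x assume x: "x \<in> support M (\<lambda>\<omega>. concat (joint Y l \<omega>))"
    show "x \<in> concat ` positive_tuples M \<Y> Y l"
    proof (rule ccontr)
      assume neg: "x \<notin> concat ` positive_tuples M \<Y> Y l"
      have "{\<omega> \<in> space M. joint Y l \<omega> = ys} \<in> null_sets M"
        if "ys \<in> {ys\<in>T. concat ys = x}" for ys
      proof -
        have "\<not> 0 < prob_mass M (joint Y l) ys"
          using that neg by (auto simp: positive_tuples_def T_def)
        then have "prob {\<omega> \<in> space M. joint Y l \<omega> = ys} = 0"
          by (simp add: prob_mass_def zero_less_measure_iff)
        then show ?thesis
          using meas by (simp add: null_sets_def emeasure_eq_measure)
      qed
      then have "{\<omega> \<in> space M. concat (joint Y l \<omega>) = x} \<in> null_sets M"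
        unfolding dec using T' by (intro null_sets_UN') auto
      then show False
        using x by (simp add: support_def prob_mass_def measure_def null_sets_def)
    qed
  next
    fix x assume "x \<in> concat ` positive_tuples M \<Y> Y l"
    then obtain ys where x: "x = concat ys" and ys: "ys \<in> positive_tuples M \<Y> Y l"
      by auto
    have "{\<omega> \<in> space M. concat (joint Y l \<omega>) = x} \<in> sets M"
      unfolding dec using T' meas by (intro sets.countable_UN') auto
    then have "prob {\<omega> \<in> space M. joint Y l \<omega> = ys} \<le> prob {\<omega> \<in> space M. concat (joint Y l \<omega>) = x}"
      by (intro finite_measure_mono) (auto simp: x)
    with ys show "x \<in> support M (\<lambda>\<omega>. concat (joint Y l \<omega>))"
      by (simp add: support_def prob_mass_def positive_tuples_def)
  qed
qed

text \<open>
  The weights of the strings of \<open>\<Y>\<close>, which need not belong to \<open>\<A>\<close>. The function \<open>w\<close> is total;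
  only its values on \<open>\<A>\<close> and \<open>\<Y>\<close> matter.
\<close>

definition additive_weight ::
    "('s list \<Rightarrow> real) \<Rightarrow> 'a measure \<Rightarrow> 's list set \<Rightarrow> (nat \<Rightarrow> 'a \<Rightarrow> 's list) \<Rightarrow> bool" where
  "additive_weight w M \<Y> Y \<longleftrightarrow>
     (\<forall>y\<in>\<Y>. 0 < w y) \<and>
     (\<forall>l\<ge>1. \<forall>ys\<in>positive_tuples M \<Y> Y l. w (concat ys) = sum_list (map w ys))"

text \<open>
  The concatenation of the first \<open>l\<close> variables determines these variables. The bound on the entropy
  rate fails without such a condition, which does not follow from \<open>input_process\<close>, where only tuples of different
  lengths are required to have different concatenations. For example, let \<open>\<Y>\<close> be \<open>{a, ab, ba}\<close>, let
  \<open>\<A>\<close> be the set of all nonempty concatenations of strings of \<open>\<Y>\<close>, let \<open>w\<close> be the length, and let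
  the \<open>Y i\<close> be independent with probabilities \<open>1/2, 1/4, 1/4\<close>. A concatenation of \<open>l\<close> strings
  contains exactly \<open>l\<close> letters \<open>a\<close>, so \<open>Y\<close> is an input process, and its entropy rate is \<open>ln 2\<close>. No
  string of \<open>\<A>\<close> contains \<open>bbb\<close>, so the capacity is less than \<open>ln 2\<close>. Here \<open>a @ ba = ab @ a\<close>.
\<close>

definition uniquely_parsed ::
    "'a measure \<Rightarrow> 's list set \<Rightarrow> (nat \<Rightarrow> 'a \<Rightarrow> 's list) \<Rightarrow> bool" where
  "uniquely_parsed M \<Y> Y \<longleftrightarrow> (\<forall>l\<ge>1. inj_on concat (positive_tuples M \<Y> Y l))"

subsection \<open>Entropy rate\<close>

text \<open>
  Shannon entropy in nats of a discrete random variable, with values in \<open>[0, \<infinity>]\<close>. The constant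
  \<open>entropy\<close> of \<open>HOL-Probability.Information\<close> is real-valued and cannot express infinite entropy.
\<close>

definition shannon_entropy :: "'a measure \<Rightarrow> ('a \<Rightarrow> 'b) \<Rightarrow> ennreal" where
  "shannon_entropy M X =
     (\<integral>\<^sup>+x. ennreal (- (prob_mass M X x * ln (prob_mass M X x))) \<partial>count_space UNIV)"

text \<open>
  The expectation is taken in \<open>[0, \<infinity>]\<close>. The quotient is the one of \<open>ennreal\<close>; in particular it is
  \<open>0\<close> if the expected weight is infinite, also for infinite entropy.
\<close>

definition entropy_rate ::
    "('s list \<Rightarrow> real) \<Rightarrow> 'a measure \<Rightarrow> (nat \<Rightarrow> 'a \<Rightarrow> 's list) \<Rightarrow> ereal" where
  "entropy_rate w M Y =
     limsup (\<lambda>l. enn2ereal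
       (shannon_entropy M (joint Y (Suc l)) / (\<integral>\<^sup>+\<omega>. ennreal (\<Sum>i<Suc l. w (Y i \<omega>)) \<partial>M)))"

end

theory Submission
  imports Defs
begin

text \<open>
  Let the series converge at \<open>\<sigma>\<close>; then \<open>\<sigma> > 0\<close>, since there are infinitely many weights. By
  unique parsing, the probabilities \<open>p\<close> of the \<open>l\<close>-tuples can be compared with the numbers
  \<open>q = exp (- \<sigma> w)\<close>: summing \<open>p * ln (q / p) \<le> q - p\<close> bounds the entropy by
  \<open>\<sigma> * E + S l - 1\<close>, where \<open>E\<close> is the expected weight and \<open>S l\<close> is the sum of \<open>q\<close> over the support
  of the \<open>l\<close>-th concatenation. As these supports are disjoint subsets of \<open>\<A>\<close>, the \<open>S l\<close> have a finite
  sum, so eventually \<open>S l \<le> 1\<close>.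

  The abscissa is at most the capacity: let \<open>N k\<close> be the number of strings of weight \<open>\<nu> k\<close> and
  \<open>T k = N 0 + \<dots> + N k\<close>. If \<open>0 < \<rho> < \<sigma>\<close> and eventually \<open>ln (T k) < \<rho> * \<nu> k\<close>, then
  \<open>exp (- \<sigma> * \<nu> k) \<le> T k powr (- \<sigma> / \<rho>)\<close>, and the series of the
  \<open>(T k - T (k - 1)) * T k powr (- \<sigma> / \<rho>)\<close> is dominated by a telescoping one.
\<close>

section \<open>The law of the tuple of the first variables\<close>

lemma sets_joint_eq:
  assumes Y: "\<And>i. Y i \<in> measurable M (count_space \<Y>)"
  shows "{\<omega> \<in> space M. joint Y l \<omega> = ys} \<in> sets M"
proof (cases "length ys = l")
  case True
  have "{\<omega> \<in> space M. Y i \<omega> = y} \<in> sets M" for i y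
  proof -
    have "{\<omega> \<in> space M. Y i \<omega> = y} = Y i -` ({y} \<inter> \<Y>) \<inter> space M"
      using measurable_space[OF Y] by auto
    also have "\<dots> \<in> sets M"
      by (rule measurable_sets[OF Y]) auto
    finally show ?thesis .
  qed
  then have "{\<omega> \<in> space M. \<forall>i\<in>{..<l}. Y i \<omega> = ys ! i} \<in> sets M"
    by (intro sets.sets_Collect_finite_All) auto
  also have "{\<omega> \<in> space M. \<forall>i\<in>{..<l}. Y i \<omega> = ys ! i} = {\<omega> \<in> space M. joint Y l \<omega> = ys}"
    using True by (auto simp: joint_def list_eq_iff_nth_eq)
  finally show ?thesis .
next
  case False
  then have "{\<omega> \<in> space M. joint Y l \<omega> = ys} = {}"
    by (auto simp: joint_def)
  then show ?thesis by (metis sets.empty_sets)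
qed

text \<open>Allows integrals over all lists to be restricted to \<open>positive_tuples\<close>: a
  tuple of positive mass is attained at some point of the space, and this forces its length to be
  \<open>l\<close> and its entries to lie in \<open>\<Y>\<close>.\<close>

lemma prob_mass_joint_eq_0:
  assumes Y: "\<And>i. Y i \<in> measurable M (count_space \<Y>)" and "ys \<notin> positive_tuples M \<Y> Y l"
  shows "prob_mass M (joint Y l) ys = 0"
proof (rule ccontr)
  assume "prob_mass M (joint Y l) ys \<noteq> 0"
  then have pos: "0 < prob_mass M (joint Y l) ys"
    by (simp add: prob_mass_def zero_less_measure_iff)
  then have "{\<omega> \<in> space M. joint Y l \<omega> = ys} \<noteq> {}"
    by (metis less_irrefl measure_empty prob_mass_def)
  then obtain \<omega> where "\<omega> \<in> space M" "joint Y l \<omega> = ys"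
    by auto
  then have "length ys = l" "set ys \<subseteq> \<Y>"
    using measurable_space[OF Y] by (auto simp: joint_def)
  with pos assms(2) show False
    by (simp add: positive_tuples_def)
qed

text \<open>Splitting the sample space by the value of the tuple turns the expectation into a sum.
  Sum and integral may be exchanged because \<open>lists \<Y>\<close> is countable, and tuples
  outside \<open>positive_tuples\<close> have mass 0.\<close>

lemma nn_integral_joint:
  fixes f :: "'b list \<Rightarrow> ennreal"
  assumes "prob_space M" and "countable \<Y>"
    and Y: "\<And>i. Y i \<in> measurable M (count_space \<Y>)"
  shows "(\<integral>\<^sup>+\<omega>. f (joint Y l \<omega>) \<partial>M) =
    (\<integral>\<^sup>+ys. f ys * prob_mass M (joint Y l) ys \<partial>count_space (positive_tuples M \<Y> Y l))"
    (is "_ = ?R")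
proof -
  interpret prob_space M by fact
  have T: "countable (lists \<Y>)"
    using assms(2) by (rule countable_lists)
  have meas: "{\<omega> \<in> space M. joint Y l \<omega> = ys} \<in> sets M" for ys
    by (rule sets_joint_eq[OF Y])
  have sub: "positive_tuples M \<Y> Y l \<subseteq> lists \<Y>"
    by (auto simp: positive_tuples_def)
  have "(\<integral>\<^sup>+\<omega>. f (joint Y l \<omega>) \<partial>M) =
      (\<integral>\<^sup>+\<omega>. \<integral>\<^sup>+ys. f ys * indicator {\<omega> \<in> space M. joint Y l \<omega> = ys} \<omega> \<partial>count_space (lists \<Y>) \<partial>M)"
  proof (rule nn_integral_cong)
    fix \<omega> assume \<omega>: "\<omega> \<in> space M"
    have "joint Y l \<omega> \<in> lists \<Y>"
      using measurable_space[OF Y \<omega>] by (auto simp: joint_def)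
    then have "(\<integral>\<^sup>+ys. f ys * indicator {joint Y l \<omega>} ys \<partial>count_space (lists \<Y>)) = f (joint Y l \<omega>)"
      by (subst nn_integral_indicator_singleton) auto
    moreover have "indicator {joint Y l \<omega>} ys =
        (indicator {\<omega> \<in> space M. joint Y l \<omega> = ys} \<omega> :: ennreal)" for ys
      using \<omega> by (auto simp: indicator_def)
    ultimately show "f (joint Y l \<omega>) =
        (\<integral>\<^sup>+ys. f ys * indicator {\<omega> \<in> space M. joint Y l \<omega> = ys} \<omega> \<partial>count_space (lists \<Y>))"
      by simp
  qed
  also have "\<dots> = (\<integral>\<^sup>+ys. \<integral>\<^sup>+\<omega>. f ys * indicator {\<omega> \<in> space M. joint Y l \<omega> = ys} \<omega> \<partial>M
      \<partial>count_space (lists \<Y>))"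
    using T meas by (intro nn_integral_count_space_nn_integral) auto
  also have "\<dots> = (\<integral>\<^sup>+ys. f ys * prob_mass M (joint Y l) ys \<partial>count_space (lists \<Y>))"
    using meas by (simp add: nn_integral_cmult_indicator emeasure_eq_measure prob_mass_def)
  also have "\<dots> = ?R"
    using sub prob_mass_joint_eq_0[OF Y]
    by (subst (1 2) nn_integral_count_space_indicator)
      (auto intro!: nn_integral_cong simp: indicator_def)
  finally show ?thesis .
qed

lemma shannon_entropy_joint:
  assumes Y: "\<And>i. Y i \<in> measurable M (count_space \<Y>)"
  shows "shannon_entropy M (joint Y l) =
    (\<integral>\<^sup>+ys. ennreal (- (prob_mass M (joint Y l) ys * ln (prob_mass M (joint Y l) ys)))
      \<partial>count_space (positive_tuples M \<Y> Y l))"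
  unfolding shannon_entropy_def
  using prob_mass_joint_eq_0[OF Y]
  by (subst (2) nn_integral_count_space_indicator)
    (auto intro!: nn_integral_cong simp: indicator_def)

section \<open>Gibbs' inequality and the entropy of a tuple\<close>

text \<open>This is \<open>ln x \<le> x - 1\<close> at \<open>x = q / p\<close>. The term
  \<open>p\<close> stays on the left, so that for \<open>p \<le> 1\<close> and
  \<open>q \<le> 1\<close> only nonnegative quantities occur and the inequality can be integrated in
  \<open>ennreal\<close>.\<close>

lemma neg_mult_ln_le:
  fixes p q :: real
  assumes "0 < p" "0 < q"
  shows "- (p * ln p) + p \<le> - ln q * p + q"
proof -
  have "p * ln (q / p) \<le> p * (q / p - 1)"
    using assms by (intro mult_left_mono ln_le_minus_one) auto
  with assms show ?thesis
    by (simp add: ln_div algebra_simps)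
qed

lemma shannon_entropy_joint_le:
  assumes "prob_space M" and "countable \<Y>"
    and Y: "\<And>i. Y i \<in> measurable M (count_space \<Y>)"
    and w: "additive_weight w M \<Y> Y" and inj: "inj_on concat (positive_tuples M \<Y> Y (Suc l))"
    and \<sigma>: "0 \<le> \<sigma>"
    and le_1: "(\<integral>\<^sup>+x. ennreal (exp (- \<sigma> * w x))
      \<partial>count_space (support M (\<lambda>\<omega>. concat (joint Y (Suc l) \<omega>)))) \<le> 1"
  shows "shannon_entropy M (joint Y (Suc l)) \<le>
    ennreal \<sigma> * (\<integral>\<^sup>+\<omega>. ennreal (\<Sum>i<Suc l. w (Y i \<omega>)) \<partial>M)"
proof -
  interpret prob_space M by fact
  let ?T = "positive_tuples M \<Y> Y (Suc l)"
  let ?p = "prob_mass M (joint Y (Suc l))"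
  have pos: "0 < ?p ys" if "ys \<in> ?T" for ys
    using that by (simp add: positive_tuples_def)
  have entropy_nonneg: "?p ys * ln (?p ys) \<le> 0" if "ys \<in> ?T" for ys
    using pos[OF that] by (intro mult_nonneg_nonpos) (auto simp: prob_mass_def)
  have add: "w (concat ys) = sum_list (map w ys)" if "ys \<in> ?T" for ys
    using w that by (auto simp: additive_weight_def)
  have nonneg: "0 \<le> sum_list (map w ys)" if "ys \<in> ?T" for ys
    using w that by (intro sum_list_nonneg) (auto simp: additive_weight_def positive_tuples_def intro: less_imp_le)
  have weight: "(\<integral>\<^sup>+\<omega>. ennreal (\<Sum>i<Suc l. w (Y i \<omega>)) \<partial>M) =
      (\<integral>\<^sup>+ys. ennreal (sum_list (map w ys)) * ?p ys \<partial>count_space ?T)"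
  proof -
    have "(\<Sum>i<Suc l. w (Y i \<omega>)) = sum_list (map w (joint Y (Suc l) \<omega>))" for \<omega>
      by (simp only: joint_def map_map comp_def atLeast0LessThan[symmetric] sum_set_upt_conv_sum_list_nat[symmetric] set_upt)
    then show ?thesis
      using nn_integral_joint[OF assms(1,2) Y,
          where f = "\<lambda>ys. ennreal (sum_list (map w ys))" and l = "Suc l"]
      by simp
  qed
  have total: "(\<integral>\<^sup>+ys. ennreal (?p ys) \<partial>count_space ?T) = 1"
    using nn_integral_joint[OF assms(1,2) Y, where f = "\<lambda>_. 1" and l = "Suc l"] by (simp add: emeasure_space_1)
  \<comment> \<open>Unique parsing enters here: each string of the support comes from exactly one
    tuple, so the sum of \<open>exp (- \<sigma> * w x)\<close> over tuples equals the sum over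
    strings.\<close>
  have "bij_betw concat ?T (support M (\<lambda>\<omega>. concat (joint Y (Suc l) \<omega>)))"
    using inj support_concat_joint[OF assms(1,2) Y] by (simp add: bij_betw_def)
  then have q: "(\<integral>\<^sup>+ys. ennreal (exp (- \<sigma> * w (concat ys))) \<partial>count_space ?T) \<le> 1"
    using le_1 by (subst nn_integral_bij_count_space) auto
  \<comment> \<open>The added 1 is the total mass of \<open>?p\<close>.\<close>
  have "shannon_entropy M (joint Y (Suc l)) + 1 =
      (\<integral>\<^sup>+ys. ennreal (- (?p ys * ln (?p ys)) + ?p ys) \<partial>count_space ?T)"
    unfolding shannon_entropy_joint[OF Y] total[symmetric]
    using pos entropy_nonneg
    by (subst nn_integral_add[symmetric])
      (auto intro!: nn_integral_cong simp: ennreal_plus[symmetric] less_imp_le simp del: ennreal_plus)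
  also have "\<dots> \<le> (\<integral>\<^sup>+ys. ennreal \<sigma> * (ennreal (sum_list (map w ys)) * ?p ys) +
      ennreal (exp (- \<sigma> * w (concat ys))) \<partial>count_space ?T)"
  proof (rule nn_integral_mono)
    fix ys assume "ys \<in> space (count_space ?T)"
    then have ys: "ys \<in> ?T" by simp
    have "- (?p ys * ln (?p ys)) + ?p ys \<le> \<sigma> * (sum_list (map w ys) * ?p ys) + exp (- \<sigma> * w (concat ys))"
      using neg_mult_ln_le[OF pos[OF ys], of "exp (- \<sigma> * w (concat ys))"] add[OF ys]
      by (simp add: mult.assoc)
    then have "ennreal (- (?p ys * ln (?p ys)) + ?p ys) \<le>
        ennreal (\<sigma> * (sum_list (map w ys) * ?p ys) + exp (- \<sigma> * w (concat ys)))"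
      by (rule ennreal_leI)
    also have "\<dots> = ennreal \<sigma> * (ennreal (sum_list (map w ys)) * ?p ys) +
        ennreal (exp (- \<sigma> * w (concat ys)))"
      using \<sigma> nonneg[OF ys] pos[OF ys] by (simp add: ennreal_mult less_imp_le)
    finally show "ennreal (- (?p ys * ln (?p ys)) + ?p ys) \<le> \<dots>" .
  qed
  also have "\<dots> = ennreal \<sigma> * (\<integral>\<^sup>+\<omega>. ennreal (\<Sum>i<Suc l. w (Y i \<omega>)) \<partial>M) +
      (\<integral>\<^sup>+ys. ennreal (exp (- \<sigma> * w (concat ys))) \<partial>count_space ?T)"
    unfolding weight by (simp add: nn_integral_add nn_integral_cmult)
  also have "\<dots> \<le> ennreal \<sigma> * (\<integral>\<^sup>+\<omega>. ennreal (\<Sum>i<Suc l. w (Y i \<omega>)) \<partial>M) + 1"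
    using q by (intro add_left_mono)
  \<comment> \<open>The summand 1 is finite, so it cancels even when the entropy or the expected
    weight is infinite.\<close>
  finally show ?thesis
    by (simp add: ennreal_add_left_cancel_le add.commute del: sum.lessThan_Suc)
qed

section \<open>The generating series at real points\<close>

lemma generating_series_of_real:
  "generating_series \<A> w \<nu> (of_real \<sigma>) k =
    of_real (real (num_strings \<A> w (\<nu> k)) * exp (- \<sigma> * \<nu> k))"
  by (simp add: generating_series_def exp_of_real[symmetric] mult.commute del: exp_of_real)

lemma summable_generating_series_iff:
  "summable (generating_series \<A> w \<nu> (of_real \<sigma>)) \<longleftrightarrow>
    summable (\<lambda>k. real (num_strings \<A> w (\<nu> k)) * exp (- \<sigma> * \<nu> k))"
  unfolding generating_series_of_real summable_of_real_iff ..

lemma num_strings_pos: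
  assumes "weight_enumeration \<A> w \<nu>"
  shows "0 < num_strings \<A> w (\<nu> k)"
proof -
  have "\<nu> k \<in> w ` \<A>"
    using assms by (auto simp: weight_enumeration_def)
  with assms show ?thesis
    unfolding num_strings_def weight_enumeration_def by (subst card_gt_0_iff) auto
qed

lemma weight_pos:
  assumes "constrained_system \<A> w" and "weight_enumeration \<A> w \<nu>"
  shows "0 < \<nu> k"
proof -
  have "\<nu> k \<in> w ` \<A>"
    using assms by (auto simp: weight_enumeration_def)
  with assms show ?thesis
    by (auto simp: constrained_system_def)
qed

text \<open>For \<open>\<sigma> \<le> 0\<close> every term is at least 1, because every weight is
  positive and is attained by some string; the terms then cannot tend to 0.\<close>

lemma summable_generating_series_pos:
  assumes "constrained_system \<A> w" and "weight_enumeration \<A> w \<nu>"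
    and "summable (generating_series \<A> w \<nu> (of_real \<sigma>))"
  shows "0 < \<sigma>"
proof (rule ccontr)
  assume "\<not> 0 < \<sigma>"
  have "1 \<le> real (num_strings \<A> w (\<nu> k)) * exp (- \<sigma> * \<nu> k)" for k
  proof -
    have "1 * 1 \<le> real (num_strings \<A> w (\<nu> k)) * exp (- \<sigma> * \<nu> k)"
      using num_strings_pos[OF assms(2), of k] weight_pos[OF assms(1,2), of k] \<open>\<not> 0 < \<sigma>\<close>
      by (intro mult_mono) (auto simp: mult_nonpos_nonneg Suc_le_eq)
    then show ?thesis by simp
  qed
  moreover have "(\<lambda>k. real (num_strings \<A> w (\<nu> k)) * exp (- \<sigma> * \<nu> k)) \<longlonglongrightarrow> 0"
    using assms(3) unfolding summable_generating_series_iff by (rule summable_LIMSEQ_zero)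
  ultimately have "(1::real) \<le> 0"
    by (intro LIMSEQ_le_const) auto
  then show False by simp
qed

section \<open>The exponential mass of the supports\<close>

text \<open>Passes from summation by weight to summation by string: the level sets
  \<open>B k\<close> of the weight are finite, disjoint and exhaust \<open>\<A>\<close>, so
  countable additivity of the measure \<open>?\<mu>\<close> identifies its total mass with the
  convergent series.\<close>

lemma nn_integral_exp_weight_finite:
  assumes enum: "weight_enumeration \<A> w \<nu>"
    and "summable (generating_series \<A> w \<nu> (of_real \<sigma>))"
  shows "(\<integral>\<^sup>+x. ennreal (exp (- \<sigma> * w x)) \<partial>count_space \<A>) < \<infinity>"
proof -
  let ?\<mu> = "density (count_space \<A>) (\<lambda>x. ennreal (exp (- \<sigma> * w x)))"
  define B where "B k = {a \<in> \<A>. w a = \<nu> k}" for k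
  have fin: "finite (B k)" for k
    using enum by (auto simp: weight_enumeration_def B_def)
  have \<A>: "\<A> = (\<Union>k. B k)"
    using enum by (auto simp: weight_enumeration_def B_def)
  have "inj \<nu>"
    using enum by (auto simp: weight_enumeration_def intro: strict_mono_imp_inj_on)
  then have disj: "disjoint_family B"
    by (auto simp: disjoint_family_on_def B_def inj_eq)
  have \<mu>: "emeasure ?\<mu> X = (\<integral>\<^sup>+x. ennreal (exp (- \<sigma> * w x)) * indicator X x \<partial>count_space \<A>)"
    if "X \<subseteq> \<A>" for X
    using that by (subst emeasure_density) auto
  have \<mu>_B: "emeasure ?\<mu> (B k) = ennreal (real (num_strings \<A> w (\<nu> k)) * exp (- \<sigma> * \<nu> k))" for k
  proof -
    have "emeasure ?\<mu> (B k) =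
        (\<integral>\<^sup>+x. ennreal (exp (- \<sigma> * \<nu> k)) * indicator (B k) x \<partial>count_space \<A>)"
      by (subst \<mu>) (auto intro!: nn_integral_cong simp: B_def indicator_def)
    also have "\<dots> = ennreal (exp (- \<sigma> * \<nu> k)) * of_nat (card (B k))"
      using fin by (subst nn_integral_cmult_indicator) (auto simp: B_def)
    finally show ?thesis
      by (simp add: num_strings_def B_def ennreal_mult ennreal_of_nat_eq_real_of_nat mult.commute)
  qed
  have "range B \<subseteq> sets ?\<mu>"
    by (auto simp: B_def)
  from suminf_emeasure[OF this disj]
  have "emeasure ?\<mu> \<A> = (\<Sum>k. ennreal (real (num_strings \<A> w (\<nu> k)) * exp (- \<sigma> * \<nu> k)))"
    by (simp only: \<mu>_B \<A>[symmetric])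
  also have "\<dots> < \<infinity>"
    using assms(2) unfolding summable_generating_series_iff
    by (subst suminf_ennreal2) auto
  finally show ?thesis
    by (simp add: emeasure_density cong: nn_integral_cong_simp)
qed

text \<open>Disjoint sets have summable masses under a finite measure, so the masses of the supports
  tend to 0.\<close>

lemma eventually_support_sum_le_1:
  assumes "weight_enumeration \<A> w \<nu>" and "summable (generating_series \<A> w \<nu> (of_real \<sigma>))"
    and source: "input_source \<A> M X"
  shows "\<forall>\<^sub>F l in sequentially.
    (\<integral>\<^sup>+x. ennreal (exp (- \<sigma> * w x)) \<partial>count_space (support M (X l))) \<le> 1"
proof -
  let ?\<mu> = "density (count_space \<A>) (\<lambda>x. ennreal (exp (- \<sigma> * w x)))"
  interpret finite_measure ?\<mu>
    using nn_integral_exp_weight_finite[OF assms(1,2)]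
    by (intro finite_measureI) (auto simp: emeasure_density cong: nn_integral_cong_simp)
  have sub: "support M (X l) \<subseteq> \<A>" for l
    using source by (auto simp: input_source_def)
  have "(\<lambda>l. measure ?\<mu> (support M (X l))) sums measure ?\<mu> (\<Union>l. support M (X l))"
    using source by (intro finite_measure_UNION) (auto simp: input_source_def disjoint_family_on_def)
  then have "(\<lambda>l. measure ?\<mu> (support M (X l))) \<longlonglongrightarrow> 0"
    by (intro summable_LIMSEQ_zero) (auto simp: sums_iff)
  then have "\<forall>\<^sub>F l in sequentially. measure ?\<mu> (support M (X l)) < 1"
    by (rule order_tendstoD) simp
  then show ?thesis
  proof eventually_elim
    case (elim l)
    have "(\<integral>\<^sup>+x. ennreal (exp (- \<sigma> * w x)) \<partial>count_space (support M (X l))) =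
        emeasure ?\<mu> (support M (X l))"
      using sub[of l] by (subst emeasure_density)
        (auto simp: nn_integral_count_space_indicator[of "support M (X l)"]
          nn_integral_count_space_indicator[of \<A>] indicator_def intro!: nn_integral_cong)
    with elim show ?case
      by (simp only: emeasure_eq_measure ennreal_le_1)
  qed
qed

text \<open>The upper limit depends only on large \<open>l\<close>, so it suffices that the mass of
  the support is eventually at most 1.\<close>

lemma entropy_rate_le_if_summable:
  assumes "constrained_system \<A> w" and "weight_enumeration \<A> w \<nu>"
    and process: "input_process \<A> M \<Y> Y"
    and "additive_weight w M \<Y> Y" and parsed: "uniquely_parsed M \<Y> Y"
    and summable: "summable (generating_series \<A> w \<nu> (of_real \<sigma>))"
  shows "entropy_rate w M Y \<le> ereal \<sigma>"
proof -
  have \<sigma>: "0 < \<sigma>"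
    using summable_generating_series_pos[OF assms(1,2) summable] .
  have source: "input_source \<A> M (\<lambda>l \<omega>. concat (joint Y (Suc l) \<omega>))"
    using process by (simp add: input_process_def)
  have "\<forall>\<^sub>F l in sequentially. enn2ereal (shannon_entropy M (joint Y (Suc l)) /
      (\<integral>\<^sup>+\<omega>. ennreal (\<Sum>i<Suc l. w (Y i \<omega>)) \<partial>M)) \<le> ereal \<sigma>"
    using eventually_support_sum_le_1[OF assms(2) summable source]
  proof eventually_elim
    case (elim l)
    let ?E = "\<integral>\<^sup>+\<omega>. ennreal (\<Sum>i<Suc l. w (Y i \<omega>)) \<partial>M"
    have le: "shannon_entropy M (joint Y (Suc l)) \<le> ennreal \<sigma> * ?E"
      using process parsed \<sigma> elim assms(4)
      by (intro shannon_entropy_joint_le[of M \<Y>]) (auto simp: input_process_def uniquely_parsed_def)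
    have "shannon_entropy M (joint Y (Suc l)) / ?E \<le> ennreal \<sigma>"
    proof (cases "?E = 0")
      \<comment> \<open>Here \<open>le\<close> forces the entropy to be 0, and
        \<open>0 / 0 = 0\<close> in \<open>ennreal\<close>.\<close>
      case True
      with le show ?thesis by simp
    next
      case False
      with le show ?thesis by (intro divide_le_posI_ennreal)
        (simp_all add: zero_less_iff_neq_zero mult.commute del: sum.lessThan_Suc)
    qed
    then have "enn2ereal (shannon_entropy M (joint Y (Suc l)) / ?E) \<le> enn2ereal (ennreal \<sigma>)"
      by (simp add: less_eq_ennreal.rep_eq)
    with \<sigma> show ?case by (simp add: enn2ereal_ennreal)
  qed
  then show ?thesis
    unfolding entropy_rate_def by (rule Limsup_bounded)
qed

section \<open>The abscissa of convergence and the capacity\<close>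

text \<open>For \<open>a \<le> b\<close> this compares the integral of
  \<open>x powr (- (1 + \<delta>))\<close> from \<open>a\<close> to \<open>b\<close> with the value
  at the right endpoint. The proof uses only \<open>ln t \<le> t - 1\<close> and
  \<open>1 + t \<le> exp t\<close>.\<close>

lemma diff_mult_powr_le:
  fixes a b \<delta> :: real
  assumes "0 < a" "0 < b" "0 < \<delta>"
  shows "(b - a) * b powr (- (1 + \<delta>)) \<le> (a powr - \<delta> - b powr - \<delta>) / \<delta>"
proof -
  have "ln (a / b) \<le> a / b - 1"
    using assms by (intro ln_le_minus_one) auto
  then have "1 - a / b \<le> ln b - ln a"
    using assms by (simp add: ln_div)
  then have "\<delta> * (1 - a / b) \<le> \<delta> * (ln b - ln a)"
    using assms by (intro mult_left_mono) auto
  also have "\<dots> \<le> exp (\<delta> * (ln b - ln a)) - 1"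
    using exp_ge_add_one_self[of "\<delta> * (ln b - ln a)"] by linarith
  finally have "b powr - \<delta> * (\<delta> * (1 - a / b)) \<le> b powr - \<delta> * (exp (\<delta> * (ln b - ln a)) - 1)"
    by (intro mult_left_mono) auto
  also have "\<dots> = a powr - \<delta> - b powr - \<delta>"
    using assms by (simp add: powr_def exp_add[symmetric] algebra_simps)
  also have "b powr - \<delta> * (\<delta> * (1 - a / b)) = \<delta> * ((b - a) * b powr (- (1 + \<delta>)))"
  proof -
    have "- (1 + \<delta>) = - \<delta> - 1"
      by simp
    then have "b powr (- (1 + \<delta>)) = b powr - \<delta> / b powr 1"
      by (simp only: powr_diff)
    then have "b powr (- (1 + \<delta>)) = b powr - \<delta> / b"
      using assms(2) by simp
    then show ?thesis
      using assms by (simp add: field_simps)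
  qed
  finally show ?thesis
    using assms by (simp add: field_simps)
qed

text \<open>Since \<open>n (Suc k) = S (Suc k) - S k\<close>, the preceding inequality bounds the
  terms after the first by a telescoping sum, whose partial sums stay below
  \<open>S 0 powr - \<delta> / \<delta>\<close>.\<close>

lemma summable_mult_partial_sum_powr:
  fixes n :: "nat \<Rightarrow> real"
  assumes n: "\<And>k. 0 < n k" and \<delta>: "0 < \<delta>"
  shows "summable (\<lambda>k. n k * (\<Sum>l\<le>k. n l) powr (- (1 + \<delta>)))"
proof -
  define S where "S k = (\<Sum>l\<le>k. n l)" for k
  have S: "0 < S k" for k
    unfolding S_def using n by (intro sum_pos) auto
  have "n (Suc k) * S (Suc k) powr (- (1 + \<delta>)) \<le> (S k powr - \<delta> - S (Suc k) powr - \<delta>) / \<delta>" for k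
    using diff_mult_powr_le[OF S S \<delta>, of "Suc k" k] by (simp add: S_def)
  then have "(\<Sum>k<m. n (Suc k) * S (Suc k) powr (- (1 + \<delta>))) \<le>
      (\<Sum>k<m. (S k powr - \<delta> - S (Suc k) powr - \<delta>) / \<delta>)" for m
    by (rule sum_mono)
  also have "(\<Sum>k<m. (S k powr - \<delta> - S (Suc k) powr - \<delta>) / \<delta>) =
      (S 0 powr - \<delta> - S m powr - \<delta>) / \<delta>" for m
    using sum_lessThan_telescope'[of "\<lambda>k. S k powr - \<delta>" m]
    by (simp add: sum_divide_distrib[symmetric])
  also have "(S 0 powr - \<delta> - S m powr - \<delta>) / \<delta> \<le> S 0 powr - \<delta> / \<delta>" for m
    using \<delta> by (intro divide_right_mono) auto
  finally have "(\<Sum>k\<le>m. n (Suc k) * S (Suc k) powr (- (1 + \<delta>))) \<le> S 0 powr - \<delta> / \<delta>" for m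
    by (simp only: lessThan_Suc_atMost[symmetric])
  moreover have "0 \<le> n (Suc k) * S (Suc k) powr (- (1 + \<delta>))" for k
    using n[of "Suc k"] by simp
  ultimately have "summable (\<lambda>k. n (Suc k) * S (Suc k) powr (- (1 + \<delta>)))"
    by (intro bounded_imp_summable)
  then show ?thesis
    unfolding S_def[symmetric] by (subst (asm) summable_Suc_iff)
qed

lemma abscissa_le_combinatorial_capacity:
  assumes "constrained_system \<A> w" and "weight_enumeration \<A> w \<nu>"
  shows "abscissa_of_convergence (generating_series \<A> w \<nu>) \<le> combinatorial_capacity \<A> w \<nu>"
proof (rule dense_ge)
  fix z assume "combinatorial_capacity \<A> w \<nu> < z"
  \<comment> \<open>Two reals are inserted between the capacity and \<open>z\<close>:
    \<open>\<rho>\<close> controls the growth of \<open>S\<close>, and the gap up to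
    \<open>\<sigma>\<close> makes the exponent below exceed 1. For infinite capacity there is no
    such \<open>z\<close>.\<close>
  then obtain \<sigma> where C\<sigma>: "combinatorial_capacity \<A> w \<nu> < ereal \<sigma>" and \<sigma>: "ereal \<sigma> < z"
    using ereal_dense2 by blast
  obtain \<rho> where C\<rho>: "combinatorial_capacity \<A> w \<nu> < ereal \<rho>" and "\<rho> < \<sigma>"
    using ereal_dense2[OF C\<sigma>] by auto
  define n where "n k = real (num_strings \<A> w (\<nu> k))" for k
  define S where "S k = (\<Sum>l\<le>k. n l)" for k
  have n: "1 \<le> n k" for k
    using num_strings_pos[OF assms(2), of k] by (simp add: n_def Suc_le_eq)
  have n0: "0 < n k" for k
    using n[of k] by simp
  have S: "1 \<le> S k" for k
  proof -
    have "n k \<le> S k"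
      unfolding S_def using n0 by (intro member_le_sum) (auto intro: less_imp_le)
    with n[of k] show ?thesis by simp
  qed
  have \<nu>: "0 < \<nu> k" for k
    by (rule weight_pos[OF assms])
  have ev: "\<forall>\<^sub>F k in sequentially. ln (S k) / \<nu> k < \<rho>"
    using Limsup_lessD[OF C\<rho>[unfolded combinatorial_capacity_def]] by (simp add: S_def n_def)
  \<comment> \<open>One index in the eventual range suffices for \<open>0 < \<rho>\<close>, as
    \<open>S k \<ge> 1\<close> makes the quotient nonnegative.\<close>
  then obtain k where "ln (S k) / \<nu> k < \<rho>"
    by (auto simp: eventually_sequentially)
  moreover have "0 \<le> ln (S k) / \<nu> k"
    using S[of k] \<nu>[of k] by simp
  ultimately have \<rho>: "0 < \<rho>" by simp
  \<comment> \<open>Chosen so that raising \<open>S k \<le> exp (\<rho> * \<nu> k)\<close> to the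
    power \<open>- (1 + \<delta>)\<close> yields exactly \<open>exp (- \<sigma> * \<nu> k)\<close>
    on the right.\<close>
  define \<delta> where "\<delta> = \<sigma> / \<rho> - 1"
  have \<delta>: "0 < \<delta>" "1 + \<delta> = \<sigma> / \<rho>"
    using \<rho> \<open>\<rho> < \<sigma>\<close> by (auto simp: \<delta>_def field_simps)
  have "summable (\<lambda>k. n k * exp (- \<sigma> * \<nu> k))"
  proof (rule summable_comparison_test_ev)
    show "summable (\<lambda>k. n k * S k powr (- (1 + \<delta>)))"
      unfolding S_def using n0 \<delta>(1) by (rule summable_mult_partial_sum_powr)
    show "\<forall>\<^sub>F k in sequentially. norm (n k * exp (- \<sigma> * \<nu> k)) \<le> n k * S k powr (- (1 + \<delta>))"
      using ev
    proof eventually_elim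
      case (elim k)
      then have "ln (S k) \<le> \<rho> * \<nu> k"
        using \<nu>[of k] by (simp add: field_simps)
      then have "\<sigma> / \<rho> * ln (S k) \<le> \<sigma> / \<rho> * (\<rho> * \<nu> k)"
        using \<rho> \<open>\<rho> < \<sigma>\<close> by (intro mult_left_mono) auto
      then have "exp (- \<sigma> * \<nu> k) \<le> exp (- (1 + \<delta>) * ln (S k))"
        using \<rho> unfolding \<delta>(2) by simp
      also have "\<dots> = S k powr (- (1 + \<delta>))"
        using S[of k] by (simp add: powr_def)
      finally show ?case
        using n0[of k] by (simp add: abs_mult)
    qed
  qed
  then have "abscissa_of_convergence (generating_series \<A> w \<nu>) \<le> ereal \<sigma>"
    unfolding abscissa_of_convergence_def
    by (intro Inf_lower imageI) (simp add: summable_generating_series_iff n_def)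
  with \<sigma> show "abscissa_of_convergence (generating_series \<A> w \<nu>) \<le> z"
    by simp
qed

theorem theorem2:
  fixes \<A> :: "'s list set" and w :: "'s list \<Rightarrow> real" and \<nu> :: "nat \<Rightarrow> real"
    and M :: "'a measure" and \<Y> :: "'s list set" and Y :: "nat \<Rightarrow> 'a \<Rightarrow> 's list"
  assumes "constrained_system \<A> w"
    and "weight_enumeration \<A> w \<nu>"
    and "input_process \<A> M \<Y> Y"
    and "additive_weight w M \<Y> Y"
    and "uniquely_parsed M \<Y> Y"
  shows "entropy_rate w M Y \<le> abscissa_of_convergence (generating_series \<A> w \<nu>) \<and>
         entropy_rate w M Y \<le> combinatorial_capacity \<A> w \<nu>"
proof -
  \<comment> \<open>The infimum is the greatest lower bound of all real points of convergence; if
    there are none, it is infinite and the bound is trivial.\<close>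
  have "entropy_rate w M Y \<le> abscissa_of_convergence (generating_series \<A> w \<nu>)"
    unfolding abscissa_of_convergence_def
    using entropy_rate_le_if_summable[OF assms] by (intro Inf_greatest) auto
  with abscissa_le_combinatorial_capacity[OF assms(1,2)] show ?thesis
    by (auto intro: order_trans)
qed

end
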